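(* Let $L_1,L,M,x$ be real numbers with $10<L_1<L<M/2$ and $x>L^2>M$. Let $\mathcal{N}$ be the set of odd composite integers $n\le x$ such that, writing $P=P^+(n)$ and $Q=P^+(n/P)$, we have $P\le L$, $PQ>M$ and $F(n)\ge\varphi(n)/L_1$. Then $$\sum_{n\in\mathcal{N}}F(n)\le x^2C,$$ where $$C=\frac{L^2}{2x}(1+\log L_1)+\frac{2(1+\log L_1)^2}{M\log M}+\frac{1}{12(M-2L)}(1+\log L)(4+\log L_1)^4\Big(\frac{5}{12}+(\zeta(3)-1)(1+\log L)\Big).$$
   Context: For a positive integer $n$, $F(n)=\#\{b\in(\mathbb{Z}/n\mathbb{Z})^\times : b^{n-1}=1\}$; $\varphi$ is Euler's totient function. $P^+(m)$ denotes the largest prime factor of $m>1$. $\zeta$ is the Riemann zeta function and $\log$ is the natural logarithm. *)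

theory Defs
  imports "HOL-Analysis.Analysis" "HOL-Number_Theory.Number_Theory"
begin

definition F :: "nat \<Rightarrow> nat" where
  "F n = card {b \<in> {0..<n}. coprime b n \<and> [b ^ (n - 1) = 1] (mod n)}"

definition Pplus :: "nat \<Rightarrow> nat" where
  "Pplus m = Max (prime_factors m)"

definition zeta_real :: "real \<Rightarrow> real" where
  "zeta_real s = (\<Sum>k. 1 / (real (Suc k)) powr s)"

end

(*
  Let P and Q be the two largest prime factors of n and put d = (P-1)/gcd(P-1,n-1) and
  e = (Q-1)/gcd(Q-1,n-1).  If P > Q, then d e divides phi(n)/F(n),
  so d e <= L1 and F(n) <= x/(d e), while n is 0 mod PQ and 1 mod lcm((P-1)/d, (Q-1)/e), which
  leaves at most x/(PQ lcm) + 1 choices of n.  Summing over (P,Q,d,e), the terms "+1" give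
  half the square of a sum of sigma(m)/m over m < L.  For the main terms write P = d g t + 1 and
  Q = e g b + 1 with g = gcd((P-1)/d, (Q-1)/e), so that the lcm is g t b; the condition PQ > M
  makes the sum over b at most 2/(M-L), and harmonic sums over d, e <= L1 and g, t <= L remain.
  The result is smaller than the third term of C because (4+a)^4 >= 144 (1+a)^2 and
  zeta(3) - 1 >= 1/6.
  If P = Q, then P divides phi(n)/F(n), so sqrt M < P <= L1; the sum of (x/P)(x/P^2) over these
  P is at most 2 x^2/M, and M < L1^2 gives ln M < 2 ln L1.
*)
theory Submission
  imports Defs
begin

section \<open>Counting solutions of b^k = 1 modulo m\<close>

definition unity_roots :: "nat \<Rightarrow> nat \<Rightarrow> nat set" where
  "unity_roots m k = {b \<in> {0..<m}. coprime b m \<and> [b ^ k = 1] (mod m)}"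

lemma finite_unity_roots: "finite (unity_roots m k)"
  by (simp add: unity_roots_def)

lemma card_unity_roots_le_totient:
  assumes "m > 0"
  shows "card (unity_roots m k) \<le> totient m"
proof -
  \<comment> \<open>For m = 1 the reduced residue is 0 while \<open>totatives 1\<close> is {1}; both
    sets have one element, so the cardinality is still \<open>totient m\<close>.\<close>
  have "{b \<in> {0..<m}. coprime b m} = (if m = 1 then {0} else totatives m)"
    using assms by (auto simp: totatives_def intro!: Nat.gr0I)
       (metis One_nat_def coprime_self le_neq_implies_less is_unit_gcd nat_dvd_1_iff_1)
  then have "card {b \<in> {0..<m}. coprime b m} = totient m"
    by (auto simp: totient_def)
  moreover have "unity_roots m k \<subseteq> {b \<in> {0..<m}. coprime b m}"
    by (auto simp: unity_roots_def)
  ultimately show ?thesis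
    by (metis (no_types, lifting) card_mono finite_Collect_conjI finite_atLeastLessThan finite_subset mem_Collect_eq subsetI)
qed

text \<open>By the Chinese remainder theorem a root modulo a * b is determined by its residues
  modulo a and b, and these residues are again roots. Injectivity of this map is enough for an upper
  bound.\<close>

lemma card_unity_roots_mult_le:
  assumes "a > 0" "b > 0" "coprime a b"
  shows "card (unity_roots (a * b) k) \<le> card (unity_roots a k) * card (unity_roots b k)"
proof -
  let ?f = "\<lambda>x. (x mod a, x mod b)"
  have "inj_on ?f (unity_roots (a * b) k)"
  proof (rule inj_onI)
    fix x y assume xy: "x \<in> unity_roots (a * b) k" "y \<in> unity_roots (a * b) k" "?f x = ?f y"
    then have "[x = y] (mod a * b)"
      using assms(3) by (intro coprime_cong_mult_nat) (auto simp: cong_def)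
    with xy show "x = y" by (auto simp: unity_roots_def cong_def)
  qed
  moreover have "?f ` unity_roots (a * b) k \<subseteq> unity_roots a k \<times> unity_roots b k"
  proof -
    have "x mod c \<in> unity_roots c k" if "x \<in> unity_roots (a * b) k" "c > 0" "c dvd a * b" for x c
    proof -
      have x: "coprime x (a * b)" "[x ^ k = 1] (mod a * b)"
        using that by (simp_all add: unity_roots_def)
      have "coprime x c"
        using coprime_divisors[OF dvd_refl that(3) x(1)] .
      moreover have "[x ^ k = 1] (mod c)"
        using cong_dvd_modulus_nat[OF x(2) that(3)] .
      ultimately show ?thesis using \<open>c > 0\<close>
        by (auto simp: unity_roots_def cong_def power_mod)
    qed
    with assms show ?thesis by auto
  qed
  ultimately have "card (unity_roots (a * b) k) \<le> card (unity_roots a k \<times> unity_roots b k)"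
    by (intro card_inj_on_le) (auto simp: finite_unity_roots)
  then show ?thesis by (simp add: card_cartesian_product)
qed

text \<open>The unit group is cyclic of order T = \<open>totient m\<close>, generated by g. The
  power g^i is a root exactly when T divides i * k, that is, when T / gcd(k, T) divides i, and only
  gcd(k, T) exponents below T have this property.\<close>

lemma card_unity_roots_primroot_le:
  assumes "residue_primroot m g" "m > 1"
  shows "card (unity_roots m k) \<le> gcd k (totient m)"
proof -
  define T where "T = totient m"
  define h where "h = gcd k T"
  have T: "T > 0" using assms by (simp add: T_def)
  then have h: "h > 0" by (simp add: h_def)
  have g: "coprime m g" "ord m g = T"
    using assms(1) by (auto simp: residue_primroot_def T_def)
  have bij: "bij_betw (\<lambda>i. g ^ i mod m) {..<T} (totatives m)"
    unfolding T_def using assms by (intro residue_primroot_is_generator) auto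
  define I where "I = {i \<in> {..<T}. (T div h) dvd i}"
  have "unity_roots m k \<subseteq> (\<lambda>i. g ^ i mod m) ` I"
  proof
    fix x assume x: "x \<in> unity_roots m k"
    then have "x \<in> totatives m"
      using assms(2) by (auto simp: unity_roots_def totatives_def intro!: Nat.gr0I)
    then obtain i where i: "i < T" "x = g ^ i mod m"
      using bij by (auto simp: bij_betw_def)
    have "[g ^ (i * k) = 1] (mod m)"
      using x i by (auto simp: unity_roots_def cong_def power_mod power_mult)
    then have "T dvd i * k" using g by (simp add: ord_divides')
    then have "T div h * h dvd i * (k div h) * h"
      by (simp add: h_def mult.assoc)
    then have "T div h dvd i * (k div h)"
      using h by (simp only: nat_mult_dvd_cancel1[of h] mult.commute[of _ h])
    moreover have "coprime (T div h) (k div h)"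
      using T unfolding h_def by (metis coprime_commute div_gcd_coprime less_numeral_extra(3))
    ultimately have "T div h dvd i" by (simp add: coprime_dvd_mult_left_iff)
    with i show "x \<in> (\<lambda>i. g ^ i mod m) ` I" by (auto simp: I_def)
  qed
  then have "card (unity_roots m k) \<le> card I"
    by (rule surj_card_le[rotated]) (simp add: I_def)
  also have "card I \<le> card {..<h}"
  \<comment> \<open>The exponents in \<open>I\<close> are multiples of T / h below T; dividing by T
    / h numbers them within 0, ..., h - 1.\<close>
  proof (rule card_inj_on_le[where f = "\<lambda>i. i div (T div h)"])
    have hT: "T = T div h * h" by (simp add: h_def)
    with T have q: "T div h > 0" by (metis mult_is_0 neq0_conv)
    show "inj_on (\<lambda>i. i div (T div h)) I"
    proof (rule inj_onI)
      fix i j assume ij: "i \<in> I" "j \<in> I" "i div (T div h) = j div (T div h)"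
      then have "i div (T div h) * (T div h) = j div (T div h) * (T div h)" by simp
      moreover have "T div h dvd i" "T div h dvd j" using ij by (auto simp: I_def)
      ultimately show "i = j" by (simp only: dvd_div_mult_self)
    qed
    show "(\<lambda>i. i div (T div h)) ` I \<subseteq> {..<h}"
    proof
      fix j assume "j \<in> (\<lambda>i. i div (T div h)) ` I"
      then obtain i where i: "i < T" "j = i div (T div h)" by (auto simp: I_def)
      then have "i < h * (T div h)" using hT by (metis mult.commute)
      with q i show "j \<in> {..<h}" by (simp add: div_less_iff_less_mult)
    qed
  qed auto
  finally show ?thesis by (simp add: h_def T_def)
qed

text \<open>The unit group modulo an odd prime power is cyclic of order p^(a-1) (p-1). As k is prime
  to p, the factor p^(a-1) contributes nothing to the gcd with k.\<close>

lemma card_unity_roots_prime_power_le: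
  assumes "prime p" "odd p" "a > 0" "\<not> p dvd k"
  shows "card (unity_roots (p ^ a) k) \<le> gcd k (p - 1)"
proof -
  obtain g where "residue_primroot (p ^ a) g"
    using assms residue_primroot_odd_prime_power_exists[of p]
    by (metis residue_primroot_iff_in_cyclic_moduli cyclic_moduli_def)
  moreover have "p ^ a > 1" using assms prime_gt_1_nat one_less_power by blast
  ultimately have "card (unity_roots (p ^ a) k) \<le> gcd k (totient (p ^ a))"
    by (rule card_unity_roots_primroot_le)
  also have "totient (p ^ a) = p ^ (a - 1) * (p - 1)"
    using assms by (simp add: totient_prime_power)
  also have "gcd k (p ^ (a - 1) * (p - 1)) = gcd k (p - 1)"
  proof -
    have "coprime k (p ^ (a - 1))"
      using prime_imp_coprime[OF assms(1,4)] by (simp add: coprime_commute)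
    then show ?thesis by (simp add: gcd_mult_right_left_cancel)
  qed
  finally show ?thesis .
qed

section \<open>Upper bounds for F(n) in terms of phi(n)\<close>

lemma F_eq_card_unity_roots: "F n = card (unity_roots n (n - 1))"
  by (simp add: F_def unity_roots_def)

lemma F_pos: "n > 1 \<Longrightarrow> F n > 0"
  unfolding F_eq_card_unity_roots card_gt_0_iff
  by (auto simp: finite_unity_roots unity_roots_def intro!: exI[of _ 1])

text \<open>This makes the prime power bound applicable with exponent n - 1 at every odd prime
  dividing n.\<close>

lemma not_prime_dvd_pred:
  fixes p n :: nat
  assumes "prime p" "p dvd n" "n > 0"
  shows "\<not> p dvd (n - 1)"
proof
  assume "p dvd n - 1"
  then have "p dvd n - (n - 1)" using assms(2) by (rule dvd_diff_nat[rotated])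
  with assms(1,3) show False by simp
qed

lemma prime_power_split:
  fixes n p :: nat
  assumes "prime p" "p dvd n" "n > 0"
  obtains a m where "n = p ^ a * m" "a > 0" "coprime (p ^ a) m" "m > 0" "\<not> p dvd m"
proof -
  obtain m where m: "n = p ^ multiplicity p n * m" "\<not> p dvd m"
    using multiplicity_decompose'[of n p] assms by (metis not_prime_unit not_gr_zero)
  moreover have "multiplicity p n > 0"
    using assms by (simp add: prime_multiplicity_gt_zero_iff)
  moreover have "coprime (p ^ multiplicity p n) m"
    using assms(1) m(2) prime_imp_coprime coprime_power_left_iff by blast
  moreover have "m > 0" using m assms by (metis mult_0_right not_gr_zero)
  ultimately show ?thesis using that by blast
qed

text \<open>The root count is at most gcd(k, p-1), so multiplying by the cofactor gives at most p -
  1. The remaining factor p^(a-1) of the totient is given away here; the repeated prime case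
  exploits it instead.\<close>

lemma card_unity_roots_prime_power_index_le:
  assumes "prime p" "odd p" "a > 0" "\<not> p dvd k"
  shows "card (unity_roots (p ^ a) k) * ((p - 1) div gcd k (p - 1)) \<le> totient (p ^ a)"
proof -
  have "card (unity_roots (p ^ a) k) * ((p - 1) div gcd k (p - 1)) \<le> gcd k (p - 1) * ((p - 1) div gcd k (p - 1))"
    using card_unity_roots_prime_power_le[OF assms] by (rule mult_right_mono) simp
  also have "\<dots> = p - 1" by simp
  also have "\<dots> \<le> p ^ (a - 1) * (p - 1)" using prime_gt_0_nat[OF assms(1)] by simp
  also have "\<dots> = totient (p ^ a)" using assms by (simp add: totient_prime_power)
  finally show ?thesis .
qed

text \<open>This is d e <= phi(n) / F(n) without division. Write n = p^a q^b l with coprime factors,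
  use the index bound at p and at q, and bound the roots modulo l trivially by its totient.\<close>

lemma F_two_primes_le:
  assumes "prime p" "prime q" "p \<noteq> q" "p dvd n" "q dvd n" "odd n"
  shows "F n * (((p - 1) div gcd (n - 1) (p - 1)) * ((q - 1) div gcd (n - 1) (q - 1))) \<le> totient n"
proof -
  have n: "n > 0" using assms by (auto intro!: Nat.gr0I)
  define k where "k = n - 1"
  have odd: "odd p" "odd q" using assms by (auto elim: dvdE)
  have k: "\<not> p dvd k" "\<not> q dvd k" using assms n not_prime_dvd_pred k_def by auto
  obtain a m where am: "n = p ^ a * m" "a > 0" "coprime (p ^ a) m" "m > 0"
    using prime_power_split[OF assms(1,4) n] by metis
  have "q dvd m" using assms am
    by (metis prime_dvd_mult_iff prime_dvd_power primes_dvd_imp_eq)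
  then obtain b l where bl: "m = q ^ b * l" "b > 0" "coprime (q ^ b) l" "l > 0"
    using prime_power_split[OF assms(2) _ am(4)] by metis
  let ?d = "(p - 1) div gcd k (p - 1)" and ?e = "(q - 1) div gcd k (q - 1)"
  let ?c = "\<lambda>m. card (unity_roots m k)"
  have "?c n \<le> ?c (p ^ a) * ?c m"
    using am card_unity_roots_mult_le[of "p ^ a" m k] prime_gt_0_nat[OF assms(1)] by simp
  also have "\<dots> \<le> ?c (p ^ a) * (?c (q ^ b) * ?c l)"
    using bl card_unity_roots_mult_le[of "q ^ b" l k] prime_gt_0_nat[OF assms(2)]
    by (intro mult_left_mono) auto
  finally have "?c n * (?d * ?e) \<le> (?c (p ^ a) * (?c (q ^ b) * ?c l)) * (?d * ?e)"
    by (rule mult_right_mono) simp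
  also have "\<dots> = (?c (p ^ a) * ?d) * ((?c (q ^ b) * ?e) * ?c l)" by (simp add: mult_ac)
  also have "\<dots> \<le> totient (p ^ a) * (totient (q ^ b) * totient l)"
    using assms odd am bl k
    by (intro mult_mono card_unity_roots_prime_power_index_le card_unity_roots_le_totient) auto
  also have "\<dots> = totient n" using am bl by (simp add: totient_mult_coprime)
  finally show ?thesis by (simp add: F_eq_card_unity_roots k_def)
qed

text \<open>Here p^a exactly divides n with a >= 2. The totient of p^a contains p^(a-1) >= p, while
  the root count modulo p^a is at most p - 1, so a full factor p is lost.\<close>

lemma F_square_le:
  assumes "prime p" "p ^ 2 dvd n" "odd n"
  shows "F n * p \<le> totient n"
proof -
  have n: "n > 0" using assms by (auto intro!: Nat.gr0I)
  have pn: "p dvd n" using assms(2) by (metis dvd_mult_left power2_eq_square)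
  define k where "k = n - 1"
  have odd: "odd p" using assms pn by (auto elim: dvdE)
  have k: "\<not> p dvd k" using assms pn n not_prime_dvd_pred k_def by auto
  obtain a m where am: "n = p ^ a * m" "a > 0" "coprime (p ^ a) m" "m > 0" "\<not> p dvd m"
    using prime_power_split[OF assms(1) pn n] by metis
  have "a \<noteq> 1"
  proof
    assume "a = 1"
    with am assms have "p * p dvd p * m" by (simp add: power2_eq_square)
    then have "p dvd m" using prime_gt_0_nat[OF assms(1)] by simp
    with am show False by simp
  qed
  with am have a: "a \<ge> 2" by simp
  let ?c = "\<lambda>m. card (unity_roots m k)"
  have "?c n \<le> ?c (p ^ a) * ?c m"
    using am card_unity_roots_mult_le[of "p ^ a" m k] prime_gt_0_nat[OF assms(1)] by simp
  also have "\<dots> \<le> (p - 1) * totient m"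
    using card_unity_roots_prime_power_le[OF assms(1) odd am(2) k] prime_gt_1_nat[OF assms(1)] am(4)
    by (intro mult_mono card_unity_roots_le_totient) (auto intro: order_trans[OF _ gcd_le2_nat])
  finally have "?c n * p \<le> (p - 1) * totient m * p" by (rule mult_right_mono) simp
  also have "\<dots> = p ^ 1 * (p - 1) * totient m" by (simp add: mult_ac)
  also have "\<dots> \<le> p ^ (a - 1) * (p - 1) * totient m"
    using a prime_gt_0_nat[OF assms(1)] by (intro mult_right_mono power_increasing) auto
  also have "\<dots> = totient n" using am assms by (simp add: totient_mult_coprime totient_prime_power)
  finally show ?thesis by (simp add: F_eq_card_unity_roots k_def)
qed

section \<open>Elementary sums: harmonic numbers, inverse squares, divisors, zeta(3)\<close>

lemma sum_inverse_le_ln: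
  assumes "real N \<le> y" "y \<ge> 1"
  shows "(\<Sum>k=1..N. 1 / real k) \<le> 1 + ln y"
proof (cases "N = 0")
  case True
  with assms show ?thesis by simp
next
  case False
  have "(\<Sum>k=1..N. 1 / real k) = harm N"
    by (simp add: harm_def inverse_eq_divide)
  \<comment> \<open>The sequence \<open>harm N - ln N\<close> decreases and has the value 1 at N =
    1.\<close>
  also have "\<dots> \<le> 1 + ln (real N)"
    using euler_mascheroni_sequence_decreasing[of 1 N] False by (simp add: harm_expand)
  also have "\<dots> \<le> 1 + ln y" using assms False by simp
  finally show ?thesis .
qed

text \<open>Telescoping with 1/(y+1)^2 <= 1/y - 1/(y+1) from the first integer b >= r gives 1/b for
  the terms after b; the term 1/b^2 <= 1/b accounts for the factor 2.\<close>

lemma sum_inverse_squares_tail_le: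
  fixes r :: real
  assumes "finite A" "r > 0" "\<And>k. k \<in> A \<Longrightarrow> real k \<ge> r"
  shows "(\<Sum>k\<in>A. 1 / real k ^ 2) \<le> 2 / r"
proof -
  define b where "b = nat \<lceil>r\<rceil>"
  have b: "b \<ge> 1" "real b \<ge> r" using assms(2) by (auto simp: b_def) linarith+
  have *: "(\<Sum>k=b..b+n. 1 / real k ^ 2) \<le> 2 / b - 1 / real (b + n)" for n
  proof (induction n)
    case 0
    have "1 / real b ^ 2 \<le> 1 / real b" using b by (simp add: field_simps power2_eq_square)
    then show ?case by simp
  next
    case (Suc n)
    have "(\<Sum>k=b..b + Suc n. 1 / real k ^ 2) = (\<Sum>k=b..b+n. 1 / real k ^ 2) + 1 / real (b + Suc n) ^ 2"
      by simp
    moreover have "1 / real (b + Suc n) ^ 2 \<le> 1 / real (b + n) - 1 / real (b + Suc n)"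
    proof -
      have "y > 0 \<Longrightarrow> 1 / (y + 1) ^ 2 \<le> 1 / y - 1 / (y + 1)" for y :: real
        by (simp add: divide_simps power2_eq_square)
      from this[of "real (b + n)"] show ?thesis using b by (simp add: add_ac)
    qed
    ultimately show ?case using Suc.IH by linarith
  qed
  have "A \<subseteq> {b..b + Max (insert 0 A)}"
  proof
    fix k assume k: "k \<in> A"
    then have "k \<le> Max (insert 0 A)" using assms(1) by simp
    moreover have "b \<le> k" using assms(3)[OF k] unfolding b_def by linarith
    ultimately show "k \<in> {b..b + Max (insert 0 A)}" by simp
  qed
  then have "(\<Sum>k\<in>A. 1 / real k ^ 2) \<le> (\<Sum>k=b..b + Max (insert 0 A). 1 / real k ^ 2)"
    by (rule sum_mono2[OF finite_atLeastAtMost]) simp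
  also have "\<dots> \<le> 2 / b - 1 / real (b + Max (insert 0 A))" by (rule *)
  also have "\<dots> \<le> 2 / b" by simp
  also have "\<dots> \<le> 2 / r" using b assms(2) by (simp add: frac_le)
  finally show ?thesis .
qed

text \<open>Telescoping starts only after the first two terms: 1 + 1/4 = 7/4 - 1/2. The resulting
  constant is small enough for the final comparison with 1 + ln 10.\<close>

lemma sum_inverse_squares_le: "(\<Sum>k=1..N. 1 / real k ^ 2) \<le> 7 / 4"
proof -
  have *: "(\<Sum>k=1..n+2. 1 / real k ^ 2) \<le> 7 / 4 - 1 / real (n + 2)" for n
  proof (induction n)
    case 0
    show ?case by (simp add: numeral_2_eq_2)
  next
    case (Suc n)
    have "y > 0 \<Longrightarrow> 1 / (y + 1) ^ 2 \<le> 1 / y - 1 / (y + 1)" for y :: real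
      by (simp add: divide_simps power2_eq_square)
    from this[of "real (n + 2)"] Suc.IH show ?case by (simp add: add_ac)
  qed
  have "(\<Sum>k=1..N. 1 / real k ^ 2) \<le> (\<Sum>k=1..N+2. 1 / real k ^ 2)"
    by (intro sum_mono2) auto
  also have "\<dots> \<le> 7 / 4 - 1 / real (N + 2)" by (rule *)
  also have "\<dots> \<le> 7 / 4" by simp
  finally show ?thesis .
qed

text \<open>The inner sum is sigma(m)/m. After exchanging the sums, each d has at most N/d multiples
  up to N, which leaves N times a sum of inverse squares.\<close>

lemma sum_sum_inverse_divisors_le:
  "(\<Sum>m=1..N. \<Sum>d | d dvd m. 1 / real d) \<le> 7 / 4 * real N"
proof -
  have "(\<Sum>m=1..N. \<Sum>d | d dvd m. 1 / real d) = (\<Sum>m=1..N. \<Sum>d\<in>{d\<in>{1..N}. d dvd m}. 1 / real d)"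
  proof (intro sum.cong refl)
    fix m assume "m \<in> {1..N}"
    then show "{d. d dvd m} = {d\<in>{1..N}. d dvd m}"
      by (auto dest: dvd_imp_le intro!: Nat.gr0I simp: Suc_le_eq)
  qed
  also have "\<dots> = (\<Sum>d=1..N. \<Sum>m\<in>{m\<in>{1..N}. d dvd m}. 1 / real d)"
    by (rule sum.swap_restrict) auto
  also have "\<dots> \<le> (\<Sum>d=1..N. real N * (1 / real d ^ 2))"
  proof (rule sum_mono)
    fix d assume d: "d \<in> {1..N}"
    have "{m\<in>{1..N}. d dvd m} \<subseteq> (\<lambda>k. d * k) ` {1..N div d}"
    proof
      fix m assume "m \<in> {m\<in>{1..N}. d dvd m}"
      then obtain k where "m = d * k" "1 \<le> m" "m \<le> N" by (auto elim: dvdE)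
      moreover from this d have "k \<le> N div d" "k \<ge> 1"
        by (auto simp: less_eq_div_iff_mult_less_eq mult.commute Suc_le_eq)
      ultimately show "m \<in> (\<lambda>k. d * k) ` {1..N div d}" by auto
    qed
    then have "card {m\<in>{1..N}. d dvd m} \<le> card {1..N div d}"
      by (rule surj_card_le[rotated]) simp
    then have "real (card {m\<in>{1..N}. d dvd m}) \<le> real (N div d)" by simp
    also have "\<dots> \<le> real N / real d" by (rule of_nat_div_le_of_nat)
    finally have "real (card {m\<in>{1..N}. d dvd m}) * (1 / real d) \<le> real N / real d * (1 / real d)"
      by (rule mult_right_mono) simp
    then show "(\<Sum>m\<in>{m\<in>{1..N}. d dvd m}. 1 / real d) \<le> real N * (1 / real d ^ 2)"
      by (simp add: power2_eq_square)
  qed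
  also have "\<dots> = real N * (\<Sum>d=1..N. 1 / real d ^ 2)" by (simp add: sum_distrib_left)
  also have "\<dots> \<le> real N * (7 / 4)" using sum_inverse_squares_le by (intro mult_left_mono) auto
  finally show ?thesis by simp
qed

text \<open>Four terms suffice: 1 + 1/8 + 1/27 + 1/64 > 7/6, whereas the first three stay below
  7/6.\<close>

lemma zeta_real_3_ge: "zeta_real 3 - 1 \<ge> 1 / 6"
proof -
  have eq: "1 / real (Suc k) powr 3 = 1 / real (Suc k) ^ 3" for k
    by (subst powr_numeral) auto
  have "summable (\<lambda>k. 1 / real k ^ 3)"
    using inverse_power_summable[of 3, where ?'a = real] by (simp add: inverse_eq_divide)
  then have "summable (\<lambda>k. 1 / real (Suc k) ^ 3)"
    by (subst summable_Suc_iff)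
  then have "(\<Sum>k<4. 1 / real (Suc k) ^ 3) \<le> (\<Sum>k. 1 / real (Suc k) ^ 3)"
    by (intro sum_le_suminf) auto
  moreover have "(\<Sum>k<4. 1 / real (Suc k) ^ 3) \<ge> 7 / 6"
    by (simp add: eval_nat_numeral)
  ultimately show ?thesis unfolding zeta_real_def eq by linarith
qed

section \<open>Counting integers in residue classes\<close>

lemma card_congruent_le:
  fixes x :: real
  assumes "m > 0" "\<And>n. n \<in> S \<Longrightarrow> real n \<le> x" "\<And>n n'. n \<in> S \<Longrightarrow> n' \<in> S \<Longrightarrow> [n = n'] (mod m)"
    "x \<ge> 0"
  shows "real (card S) \<le> x / real m + 1"
proof -
  \<comment> \<open>All elements of \<open>S\<close> share one remainder modulo m, so the quotient
    determines the element. Quotients start at 0, which is the source of the summand 1.\<close>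
  have "inj_on (\<lambda>n. n div m) S"
  proof (rule inj_onI)
    fix n n' assume "n \<in> S" "n' \<in> S" "n div m = n' div m"
    with assms(3)[of n n'] show "n = n'"
      by (metis cong_def div_mult_mod_eq)
  qed
  moreover have "(\<lambda>n. n div m) ` S \<subseteq> {..nat \<lfloor>x / m\<rfloor>}"
  proof
    fix j assume "j \<in> (\<lambda>n. n div m) ` S"
    then obtain n where n: "n \<in> S" "j = n div m" by auto
    have "real j \<le> real n / real m" unfolding n by (rule of_nat_div_le_of_nat)
    also have "\<dots> \<le> x / m" using assms n by (simp add: divide_right_mono)
    finally show "j \<in> {..nat \<lfloor>x / m\<rfloor>}" by (simp add: le_nat_floor)
  qed
  ultimately have "card S \<le> card {..nat \<lfloor>x / m\<rfloor>}" by (intro card_inj_on_le) auto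
  then have "real (card S) \<le> real (nat \<lfloor>x / m\<rfloor>) + 1" by simp
  also have "\<dots> \<le> x / m + 1" using assms by simp
  finally show ?thesis .
qed

text \<open>Leaving out n = 0 avoids the summand 1, so the repeated prime case has no error
  term.\<close>

lemma card_multiples_le:
  fixes x :: real
  assumes "c > 0" "x \<ge> 0"
  shows "real (card {n. 0 < n \<and> real n \<le> x \<and> c dvd n}) \<le> x / real c"
proof -
  have "{n. 0 < n \<and> real n \<le> x \<and> c dvd n} \<subseteq> (\<lambda>k. c * k) ` {1..nat \<lfloor>x / c\<rfloor>}"
  proof
    fix n assume "n \<in> {n. 0 < n \<and> real n \<le> x \<and> c dvd n}"
    then obtain k where k: "n = c * k" "0 < n" "real n \<le> x" by (auto elim: dvdE)
    then have "real k \<le> x / c" using assms by (simp add: field_simps)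
    then have "k \<le> nat \<lfloor>x / c\<rfloor>" by (rule le_nat_floor)
    moreover have "k \<ge> 1" using k by (cases k) auto
    ultimately show "n \<in> (\<lambda>k. c * k) ` {1..nat \<lfloor>x / c\<rfloor>}" using k(1) by auto
  qed
  then have "card {n. 0 < n \<and> real n \<le> x \<and> c dvd n} \<le> card {1..nat \<lfloor>x / c\<rfloor>}"
    by (rule surj_card_le[rotated]) simp
  then have "real (card {n. 0 < n \<and> real n \<le> x \<and> c dvd n}) \<le> real (nat \<lfloor>x / c\<rfloor>)" by simp
  also have "\<dots> \<le> x / c" using assms by simp
  finally show ?thesis .
qed

text \<open>Any n in the set is divisible by c and is 1 modulo lcm(a, b), so c and the lcm are
  coprime as soon as the set is nonempty. All members then lie in a single class modulo c * lcm(a,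
  b).\<close>

lemma card_multiples_cong_1_le:
  fixes x :: real
  assumes "c > 0" "a > 0" "b > 0" "x \<ge> 0"
  shows "real (card {n. 0 < n \<and> real n \<le> x \<and> c dvd n \<and> [n = 1] (mod a) \<and> [n = 1] (mod b)})
         \<le> x / real (c * lcm a b) + 1"
proof (rule card_congruent_le)
  fix n n' assume n: "n \<in> {n. 0 < n \<and> real n \<le> x \<and> c dvd n \<and> [n = 1] (mod a) \<and> [n = 1] (mod b)}"
    and n': "n' \<in> {n. 0 < n \<and> real n \<le> x \<and> c dvd n \<and> [n = 1] (mod a) \<and> [n = 1] (mod b)}"
  have l: "[n = 1] (mod lcm a b)" "[n' = 1] (mod lcm a b)"
    using n n' by (auto intro: cong_cong_lcm_nat)
  then have "coprime n (lcm a b)"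
    by (metis cong_imp_coprime cong_sym coprime_1_left)
  moreover have "c dvd n" using n by simp
  ultimately have "coprime c (lcm a b)" using coprime_divisors[OF _ dvd_refl] by blast
  moreover have "[n = n'] (mod c)" using n n' by (simp add: cong_def)
  moreover have "[n = n'] (mod lcm a b)" using l cong_sym cong_trans by blast
  ultimately show "[n = n'] (mod (c * lcm a b))" by (rule coprime_cong_mult_nat[rotated 2])
qed (use assms in \<open>simp_all add: lcm_pos_nat\<close>)

section \<open>Sums over the quadruples (p, q, d, e)\<close>

definition quads :: "real \<Rightarrow> nat \<Rightarrow> nat \<Rightarrow> (nat \<times> nat \<times> nat \<times> nat) set" where
  "quads M D N = {(p, q, d, e). 2 \<le> q \<and> q < p \<and> p \<le> N \<and> real (p * q) > M \<and>
     d dvd p - 1 \<and> e dvd q - 1 \<and> d * e \<le> D}"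

text \<open>The conditions coupling the pairs through M and D are dropped; for fixed p and q the
  divisors d and e then vary independently, so sums over them factor.\<close>

lemma quads_subset:
  "quads M D N \<subseteq> (SIGMA p:{2..N}. SIGMA q:{q\<in>{2..N}. q < p}. {d. d dvd p - 1} \<times> {e. e dvd q - 1})"
  by (auto simp: quads_def)

lemma finite_quads: "finite (quads M D N)"
  by (rule finite_subset[OF quads_subset])
     (auto intro!: finite_SigmaI finite_divisors_nat)

text \<open>By symmetry the pairs q < p and the pairs q > p contribute equally, and together they
  form the full square without its nonnegative diagonal.\<close>

lemma sum_less_pairs_le:
  fixes f :: "nat \<Rightarrow> real"
  assumes "finite A" "\<And>p. p \<in> A \<Longrightarrow> f p \<ge> 0"
  shows "(\<Sum>p\<in>A. \<Sum>q\<in>{q\<in>A. q < p}. f p * f q) \<le> (\<Sum>p\<in>A. f p) ^ 2 / 2"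
proof -
  let ?S = "\<Sum>p\<in>A. \<Sum>q\<in>{q\<in>A. q < p}. f p * f q"
  have "?S = (\<Sum>q\<in>A. \<Sum>p\<in>{p\<in>A. q < p}. f p * f q)"
    using assms(1) by (intro sum.swap_restrict) auto
  then have "?S + ?S = (\<Sum>p\<in>A. (\<Sum>q\<in>{q\<in>A. q < p}. f p * f q) + (\<Sum>q\<in>{q\<in>A. p < q}. f p * f q))"
    by (simp add: sum.distrib mult.commute)
  also have "\<dots> = (\<Sum>p\<in>A. (\<Sum>q\<in>{q\<in>A. q < p} \<union> {q\<in>A. p < q}. f p * f q))"
    using assms(1) by (intro sum.cong refl sum.union_disjoint[symmetric]) auto
  also have "\<dots> \<le> (\<Sum>p\<in>A. \<Sum>q\<in>A. f p * f q)"
    using assms by (intro sum_mono sum_mono2) auto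
  also have "\<dots> = (\<Sum>p\<in>A. f p) ^ 2"
    by (simp add: power2_eq_square sum_product)
  finally show ?thesis by simp
qed

text \<open>This controls the contribution of the summand 1 in the count of n. Over the larger index
  set the sum factors into f(p) f(q) with f(p) = sigma(p-1)/(p-1), whence the constant (7/4)^2 / 2 =
  49/32.\<close>

lemma sum_quads_inverse_le:
  "(\<Sum>(p, q, d, e)\<in>quads M D N. 1 / (real d * real e)) \<le> 49 / 32 * real N ^ 2"
proof -
  define f where "f p = (\<Sum>d | d dvd p - 1. 1 / real d)" for p :: nat
  let ?B = "SIGMA p:{2..N}. SIGMA q:{q\<in>{2..N}. q < p}. {d. d dvd p - 1} \<times> {e. e dvd q - 1}"
  have "(\<Sum>(p, q, d, e)\<in>quads M D N. 1 / (real d * real e)) \<le> (\<Sum>(p, q, d, e)\<in>?B. 1 / (real d * real e))"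
    by (rule sum_mono2[OF _ quads_subset]) (auto intro!: finite_SigmaI finite_divisors_nat)
  also have "\<dots> = (\<Sum>p\<in>{2..N}. \<Sum>q\<in>{q\<in>{2..N}. q < p}. \<Sum>(d, e)\<in>{d. d dvd p - 1} \<times> {e. e dvd q - 1}. 1 / (real d * real e))"
    by (rule trans[OF sum.Sigma[symmetric]], simp, (auto intro!: finite_SigmaI finite_divisors_nat)[1],
        rule sum.cong[OF refl], rule sum.Sigma[symmetric])
       (auto intro!: finite_divisors_nat)
  also have "\<dots> = (\<Sum>p\<in>{2..N}. \<Sum>q\<in>{q\<in>{2..N}. q < p}. f p * f q)"
    by (intro sum.cong refl) (simp add: f_def sum_product sum.cartesian_product)
  also have "\<dots> \<le> (\<Sum>p\<in>{2..N}. f p) ^ 2 / 2"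
    by (rule sum_less_pairs_le) (auto simp: f_def intro: sum_nonneg)
  also have "(\<Sum>p\<in>{2..N}. f p) = (\<Sum>m=1..N-1. \<Sum>d | d dvd m. 1 / real d)"
    unfolding f_def by (rule sum.reindex_bij_witness[where i = Suc and j = "\<lambda>p. p - 1"]) auto
  also have "\<dots> ^ 2 \<le> (7 / 4 * real N) ^ 2"
  proof (rule power_mono)
    have "(\<Sum>m=1..N-1. \<Sum>d | d dvd m. 1 / real d) \<le> 7 / 4 * real (N - 1)"
      by (rule sum_sum_inverse_divisors_le)
    also have "\<dots> \<le> 7 / 4 * real N" by simp
    finally show "(\<Sum>m=1..N-1. \<Sum>d | d dvd m. 1 / real d) \<le> 7 / 4 * real N" .
  qed (intro sum_nonneg, simp)
  finally show ?thesis by (simp add: power_mult_distrib power2_eq_square)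
qed

text \<open>Take g as the gcd of the cofactors (p-1)/d and (q-1)/e, and t and b as the coprime parts
  left over; gcd times lcm equals the product, so the lcm is g t b. The ranges follow since d and e
  divide d e, while g, t and b divide p - 1 or q - 1.\<close>

lemma quads_witness:
  assumes "(p, q, d, e) \<in> quads M D N"
  obtains g t b where "p = d * g * t + 1" "q = e * g * b + 1"
    "lcm ((p - 1) div d) ((q - 1) div e) = g * t * b"
    "d \<in> {1..D}" "e \<in> {1..D}" "g \<in> {1..N}" "t \<in> {1..N}" "b \<in> {1..N}"
proof -
  have *: "2 \<le> q" "q < p" "p \<le> N" "d dvd p - 1" "e dvd q - 1" "d * e \<le> D"
    using assms by (auto simp: quads_def)
  define a where "a = (p - 1) div d"
  define c where "c = (q - 1) div e"
  define g where "g = gcd a c"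
  define t where "t = a div g"
  define b where "b = c div g"
  have p: "p - 1 = d * a" and q: "q - 1 = e * c" using * by (simp_all add: a_def c_def)
  have pos: "d > 0" "a > 0" "e > 0" "c > 0" using p q * by (auto intro!: Nat.gr0I)
  then have g: "g > 0" by (simp add: g_def)
  have a: "a = g * t" and c: "c = g * b" by (simp_all add: t_def b_def g_def)
  have pos': "t > 0" "b > 0" using pos a c by (auto intro!: Nat.gr0I)
  have "g * lcm a c = g * (g * t * b)"
    using prod_gcd_lcm_nat[of a c] unfolding g_def[symmetric] by (metis a c mult.assoc mult.commute)
  then have lcm: "lcm a c = g * t * b" using g by simp
  have "d \<le> d * e" "e \<le> d * e" using pos by auto
  moreover have "a \<le> d * a" "c \<le> e * c" "g \<le> g * t" "t \<le> g * t" "b \<le> g * b" using pos pos' g by auto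
  ultimately have "d \<le> D" "e \<le> D" "g \<le> N" "t \<le> N" "b \<le> N" using * p q a c by linarith+
  moreover have "p = d * g * t + 1" "q = e * g * b + 1" using * p q a c by (simp_all add: mult.assoc)
  ultimately show ?thesis using that[of g t b] lcm pos pos' g by (simp add: a_def c_def)
qed

text \<open>In the parameters (d, e, g, t, b) the summand decays like 1/b^2, and p q > M forces b to
  be large. Summing over b first yields 2/(M-L) times 1/(d e g t), and four harmonic sums
  remain.\<close>

lemma sum_quads_lcm_le:
  assumes "real N \<le> L" "L < M" "real D \<le> L1" "L1 \<ge> 1" "L \<ge> 1"
  shows "(\<Sum>(p, q, d, e)\<in>quads M D N.
            1 / (real d * real e * real (p * q * lcm ((p - 1) div d) ((q - 1) div e))))
         \<le> 2 / (M - L) * (1 + ln L1) ^ 2 * (1 + ln L) ^ 2"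
proof -
  define P where "P d g t = d * g * t + 1" for d g t :: nat
  \<comment> \<open>The condition p <= N sits inside \<open>B\<close>: too large a p just empties
    the range of b, so d, e, g and t can run over full intervals.\<close>
  define B where "B d e g t = {b \<in> {1..N}. P d g t \<le> N \<and> real (P d g t * P e g b) > M}" for d e g t
  define h where "h d e g t b = 1 / (real d * real e * (real g * real t * real b) * real (P d g t) * real (P e g b))"
    for d e g t b :: nat
  have "(\<Sum>(p, q, d, e)\<in>quads M D N.
            1 / (real d * real e * real (p * q * lcm ((p - 1) div d) ((q - 1) div e))))
       \<le> (\<Sum>(d, e, g, t, b)\<in>(SIGMA d:{1..D}. SIGMA e:{1..D}. SIGMA g:{1..N}. SIGMA t:{1..N}. B d e g t). h d e g t b)"
  \<comment> \<open>The map recovers (p, q, d, e) from the parameters. One preimage per quadruple is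
    enough, as all other tuples add nonnegative terms.\<close>
  proof (rule sum_le_included[where i = "\<lambda>(d, e, g, t, b). (P d g t, P e g b, d, e)"], goal_cases)
    case 4
    show ?case
    proof (rule ballI, clarify)
      fix p q d e assume quad: "(p, q, d, e) \<in> quads M D N"
      from quads_witness[OF quad] obtain g t b where w: "p = d * g * t + 1" "q = e * g * b + 1"
        "lcm ((p - 1) div d) ((q - 1) div e) = g * t * b"
        "d \<in> {1..D}" "e \<in> {1..D}" "g \<in> {1..N}" "t \<in> {1..N}" "b \<in> {1..N}" by blast
      have P: "P d g t = p" "P e g b = q" using w by (simp_all add: P_def)
      have b: "b \<in> B d e g t" using w(8) quad unfolding B_def mem_Collect_eq P quads_def by blast
      have "1 / (real d * real e * real (p * q * lcm ((p - 1) div d) ((q - 1) div e))) = h d e g t b"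
        unfolding w(3) h_def P by (simp only: of_nat_mult mult_ac)
      with w b show "\<exists>y\<in>(SIGMA d:{1..D}. SIGMA e:{1..D}. SIGMA g:{1..N}. SIGMA t:{1..N}. B d e g t).
           (case y of (d, e, g, t, b) \<Rightarrow> (P d g t, P e g b, d, e)) = (p, q, d, e) \<and>
           1 / (real d * real e * real (p * q * lcm ((p - 1) div d) ((q - 1) div e)))
           \<le> (case y of (d, e, g, t, b) \<Rightarrow> h d e g t b)"
        by (intro bexI[of _ "(d, e, g, t, b)"]) (simp_all only: prod.case P mem_Sigma_iff order_refl simp_thms)
    qed
  next
    case 3
    then show ?case by (auto simp: h_def)
  qed (auto simp: finite_quads B_def intro!: finite_SigmaI)
  also have "\<dots> = (\<Sum>d=1..D. \<Sum>e=1..D. \<Sum>g=1..N. \<Sum>t=1..N. \<Sum>b\<in>B d e g t. h d e g t b)"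
    by (rule trans[OF sum.Sigma[symmetric]], simp, simp add: B_def, rule sum.cong[OF refl])+ (rule refl)
  also have "\<dots> \<le> (\<Sum>d=1..D. \<Sum>e=1..D. \<Sum>g=1..N. \<Sum>t=1..N. 
       2 / (M - L) * (1 / real d * (1 / real e * (1 / real g * (1 / real t)))))"
  proof (intro sum_mono)
    fix d e g t assume "d \<in> {1..D}" "e \<in> {1..D}" "g \<in> {1..N}" "t \<in> {1..N}"
    then have pos: "d > 0" "e > 0" "g > 0" "t > 0" by auto
    define k where "k = real d * real e * real g * real t"
    have k: "k > 0" using pos by (simp add: k_def)
    show "(\<Sum>b\<in>B d e g t. h d e g t b) \<le> 2 / (M - L) * (1 / real d * (1 / real e * (1 / real g * (1 / real t))))"
    proof (cases "P d g t \<le> N")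
      case True
      \<comment> \<open>u is the coefficient of b in p q = u b + p. From p q > M and p <= L follows
        b >= (M - L)/u, and the u in the tail bound cancels the u in the summand.\<close>
      define u where "u = real (P d g t) * real e * real g"
      have u: "u > 0" using pos unfolding u_def P_def by (intro mult_pos_pos) (auto simp only: of_nat_0_less_iff)
      have "(\<Sum>b\<in>B d e g t. h d e g t b) \<le> (\<Sum>b\<in>B d e g t. 1 / (k * u) * (1 / real b ^ 2))"
      proof (rule sum_mono)
        fix b assume "b \<in> B d e g t"
        then have b: "b > 0" by (simp add: B_def)
        have "h d e g t b = 1 / (k * (real b * real (P d g t) * real (P e g b)))"
          by (simp add: h_def k_def mult_ac)
        \<comment> \<open>Replacing q = e g b + 1 by e g b makes the bound a constant multiple of
          1/b^2.\<close>
        also have "\<dots> \<le> 1 / (k * (real b * real (P d g t) * (real e * real g * real b)))"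
        proof (intro divide_left_mono mult_left_mono)
          have "P d g t > 0" "P e g b > 0" by (simp_all add: P_def)
          then show "0 < k * (real b * real (P d g t) * real (P e g b)) * (k * (real b * real (P d g t) * (real e * real g * real b)))"
            using k b pos by simp
          show "real e * real g * real b \<le> real (P e g b)" by (simp add: P_def)
        qed (use k in auto)
        also have "\<dots> = 1 / (k * u) * (1 / real b ^ 2)" by (simp add: u_def power2_eq_square)
        finally show "h d e g t b \<le> 1 / (k * u) * (1 / real b ^ 2)" .
      qed
      also have "\<dots> = 1 / (k * u) * (\<Sum>b\<in>B d e g t. 1 / real b ^ 2)" by (simp add: sum_distrib_left)
      also have "\<dots> \<le> 1 / (k * u) * (2 / ((M - L) / u))"
      proof (intro mult_left_mono sum_inverse_squares_tail_le)
        fix b assume "b \<in> B d e g t"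
        then have "M < real (P d g t * P e g b)" by (simp add: B_def)
        also have "\<dots> = u * real b + real (P d g t)" by (simp add: u_def P_def[of e] algebra_simps)
        also have "real (P d g t) \<le> L" using True assms(1) by linarith
        finally show "(M - L) / u \<le> real b" using u by (simp add: field_simps)
      qed (use k u assms in \<open>auto simp: B_def\<close>)
      also have "\<dots> = 2 / (M - L) * (1 / k)" using u by simp
      finally show ?thesis by (simp add: k_def mult_ac)
    next
      case False
      then have "B d e g t = {}" by (auto simp: B_def)
      then show ?thesis using assms pos by simp
    qed
  qed
  also have "\<dots> = 2 / (M - L) * ((\<Sum>d=1..D. 1 / real d) * ((\<Sum>e=1..D. 1 / real e) * ((\<Sum>g=1..N. 1 / real g) * (\<Sum>t=1..N. 1 / real t))))"
    by (simp only: sum_distrib_left[symmetric] sum_distrib_right[symmetric])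
  also have "\<dots> \<le> 2 / (M - L) * ((1 + ln L1) * ((1 + ln L1) * ((1 + ln L) * (1 + ln L))))"
    using assms by (intro mult_left_mono mult_mono sum_inverse_le_ln mult_nonneg_nonneg sum_nonneg) auto
  finally show ?thesis by (simp add: power2_eq_square mult_ac)
qed

section \<open>Summing F(n) when the two primes are distinct or equal\<close>

lemma index_mult_le_of_F_ge:
  fixes L1 :: real
  assumes "n > 1" "L1 > 0" "real (totient n) / L1 \<le> real (F n)" "F n * k \<le> totient n"
  shows "real k \<le> L1" "real (F n) * real k \<le> real n"
proof -
  have k: "real (F n) * real k \<le> real (totient n)"
    using assms(4) by (simp only: of_nat_mult[symmetric] of_nat_le_iff)
  also have "\<dots> \<le> real (F n) * L1" using assms(2,3) by (simp add: field_simps)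
  finally show "real k \<le> L1" using F_pos[OF assms(1)] by simp
  have "real (totient n) \<le> real n" using totient_le by simp
  with k show "real (F n) * real k \<le> real n" by linarith
qed

text \<open>Each n is charged to a quadruple with weight x/(d e). The main part x/(p q lcm) of the
  count is summed by \<open>sum_quads_lcm_le\<close>, the summand 1 by
  \<open>sum_quads_inverse_le\<close>.\<close>

lemma sum_F_distinct_le:
  fixes x L M L1 :: real
  assumes "finite S" "x \<ge> 0" "L1 \<ge> 1" "L \<ge> 1" "L < M"
    and S: "\<And>n. n \<in> S \<Longrightarrow> n > 1 \<and> real n \<le> x \<and> odd n \<and> real (totient n) / L1 \<le> real (F n) \<and>
      (\<exists>p q. prime p \<and> prime q \<and> q < p \<and> real p \<le> L \<and> real (p * q) > M \<and> p dvd n \<and> q dvd n)"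
  shows "(\<Sum>n\<in>S. real (F n)) \<le> 49 / 32 * L ^ 2 * x + 2 / (M - L) * (1 + ln L1) ^ 2 * (1 + ln L) ^ 2 * x ^ 2"
proof -
  define N where "N = nat \<lfloor>L\<rfloor>"
  define D where "D = nat \<lfloor>L1\<rfloor>"
  have ND: "real N \<le> L" "real D \<le> L1" using assms by (simp_all add: N_def D_def)
  let ?m = "\<lambda>p q d e. p * q * lcm ((p - 1) div d) ((q - 1) div e)"
  define T where "T p q d e = {n. 0 < n \<and> real n \<le> x \<and> p * q dvd n \<and>
    [n = 1] (mod (p - 1) div d) \<and> [n = 1] (mod (q - 1) div e)}" for p q d e :: nat
  have finT: "finite (T p q d e)" for p q d e
  proof (rule finite_subset)
    show "T p q d e \<subseteq> {..nat \<lfloor>x\<rfloor>}" by (auto simp: T_def le_nat_floor)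
  qed simp
  have "(\<Sum>n\<in>S. real (F n)) \<le> (\<Sum>((p, q, d, e), n)\<in>(SIGMA (p, q, d, e):quads M D N. T p q d e). x / (real d * real e))"
  proof (rule sum_le_included[where i = snd], goal_cases)
    case 4
    show ?case
    proof
      fix n assume "n \<in> S"
      from S[OF this] obtain p q where n: "n > 1" "real n \<le> x" "odd n" "real (totient n) / L1 \<le> real (F n)"
        and pq: "prime p" "prime q" "q < p" "real p \<le> L" "real (p * q) > M" "p dvd n" "q dvd n"
        by blast
      define d where "d = (p - 1) div gcd (n - 1) (p - 1)"
      define e where "e = (q - 1) div gcd (n - 1) (q - 1)"
      have "F n * (d * e) \<le> totient n"
        unfolding d_def e_def using pq n by (intro F_two_primes_le) auto
      then have de: "real (d * e) \<le> L1" "real (F n) * real (d * e) \<le> real n"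
        using index_mult_le_of_F_ge[of n L1 "d * e"] n assms(3) by auto
      have "p > 1" "q > 1" using pq prime_gt_1_nat by blast+
      then have p0: "p - 1 > 0" "q - 1 > 0" by auto
      \<comment> \<open>The cofactor of d in p - 1 is the gcd with n - 1 again, hence a divisor of n
        - 1; this yields the congruences in \<open>T\<close>. The same holds for e and q.\<close>
      have gd: "(p - 1) div d = gcd (n - 1) (p - 1)" "(q - 1) div e = gcd (n - 1) (q - 1)"
        using p0 unfolding d_def e_def by (auto intro!: div_div_eq_right[THEN trans] simp: div_div_eq_right)
      have dd: "d dvd p - 1" "e dvd q - 1" unfolding d_def e_def by (metis dvd_div_mult_self dvd_triv_left gcd_dvd2)+
      then have pos: "d > 0" "e > 0" using p0 by (auto intro!: Nat.gr0I)
      have "coprime p q" using pq by (intro primes_coprime) auto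
      then have "p * q dvd n" using pq by (intro divides_mult) auto
      moreover have "[n = 1] (mod gcd (n - 1) m)" for m
        using n(1) by (metis cong_altdef_nat gcd_dvd1 less_imp_le)
      ultimately have nT: "n \<in> T p q d e" using n gd by (auto simp: T_def)
      have "p \<le> N" using pq(4) by (simp add: N_def le_nat_floor)
      moreover have "d * e \<le> D" using de(1) unfolding D_def by (rule le_nat_floor)
      \<comment> \<open>Primality of p and q is forgotten at this point: summing over all integer
        pairs only enlarges a sum of nonnegative terms.\<close>
      ultimately have quad: "(p, q, d, e) \<in> quads M D N"
        using pq dd \<open>q > 1\<close> by (simp add: quads_def)
      have "real (F n) \<le> x / (real d * real e)"
        using de(2) n(2) pos by (simp add: field_simps)
      with quad nT show "\<exists>y\<in>(SIGMA (p, q, d, e):quads M D N. T p q d e). snd y = n \<and>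
          real (F n) \<le> (\<lambda>((p, q, d, e), n). x / (real d * real e)) y"
        by (intro bexI[of _ "((p, q, d, e), n)"]) auto
    qed
  qed (use assms finite_quads finT in \<open>auto intro!: finite_SigmaI\<close>)
  also have "\<dots> = (\<Sum>(p, q, d, e)\<in>quads M D N. x / (real d * real e) * real (card (T p q d e)))"
    by (subst sum.Sigma[symmetric]) (auto simp: finite_quads finT mult.commute intro!: sum.cong)
  also have "\<dots> \<le> (\<Sum>(p, q, d, e)\<in>quads M D N. x * (1 / (real d * real e)) +
       x ^ 2 * (1 / (real d * real e * real (?m p q d e))))"
  proof (rule sum_mono, clarify)
    fix p q d e assume quad: "(p, q, d, e) \<in> quads M D N"
    \<comment> \<open>The parametrization shows that p q and both moduli (p-1)/d and (q-1)/e are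
      positive, as the counting lemma requires.\<close>
    from quads_witness[OF this] obtain g t b where w: "p = d * g * t + 1" "q = e * g * b + 1"
        "d \<in> {1..D}" "e \<in> {1..D}" "g \<in> {1..N}" "t \<in> {1..N}" "b \<in> {1..N}" by metis
    have "real (card (T p q d e)) \<le> x / real (?m p q d e) + 1"
      unfolding T_def using w assms(2) by (intro card_multiples_cong_1_le) (auto simp: mult.assoc)
    then have "x / (real d * real e) * real (card (T p q d e)) \<le> x / (real d * real e) * (x / real (?m p q d e) + 1)"
      using assms(2) by (intro mult_left_mono) auto
    also have "\<dots> = x * (1 / (real d * real e)) + x ^ 2 * (1 / (real d * real e * real (?m p q d e)))"
      by (simp add: distrib_left power2_eq_square)
    finally show "x / (real d * real e) * real (card (T p q d e)) \<le>
       x * (1 / (real d * real e)) + x ^ 2 * (1 / (real d * real e * real (?m p q d e)))" .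
  qed
  also have "\<dots> = x * (\<Sum>(p, q, d, e)\<in>quads M D N. 1 / (real d * real e)) +
       x ^ 2 * (\<Sum>(p, q, d, e)\<in>quads M D N. 1 / (real d * real e * real (?m p q d e)))"
    by (simp only: sum_distrib_left sum.distrib[symmetric] case_prod_unfold)
  also have "\<dots> \<le> x * (49 / 32 * L ^ 2) + x ^ 2 * (2 / (M - L) * (1 + ln L1) ^ 2 * (1 + ln L) ^ 2)"
  proof (intro add_mono mult_left_mono)
    have "(\<Sum>(p, q, d, e)\<in>quads M D N. 1 / (real d * real e)) \<le> 49 / 32 * real N ^ 2"
      by (rule sum_quads_inverse_le)
    also have "\<dots> \<le> 49 / 32 * L ^ 2" using ND by (intro mult_left_mono power_mono) auto
    finally show "(\<Sum>(p, q, d, e)\<in>quads M D N. 1 / (real d * real e)) \<le> 49 / 32 * L ^ 2" .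
    show "(\<Sum>(p, q, d, e)\<in>quads M D N. 1 / (real d * real e * real (?m p q d e)))
        \<le> 2 / (M - L) * (1 + ln L1) ^ 2 * (1 + ln L) ^ 2"
      using ND assms by (intro sum_quads_lcm_le) auto
  qed (use assms in auto)
  finally show ?thesis by (simp add: mult_ac)
qed

text \<open>If p^2 divides n, then F(n) p <= phi(n) gives both p <= L1 and F(n) <= x/p. At most
  x/p^2 integers n belong to p, so the total is at most x^2 times the sum of 1/p^3 over integers p
  in [sqrt M, L1].\<close>

lemma sum_F_square_le:
  fixes x M L1 :: real
  assumes "finite S" "x \<ge> 0" "L1 > 10" "M > 1"
    and S: "\<And>n. n \<in> S \<Longrightarrow> n > 1 \<and> real n \<le> x \<and> odd n \<and> real (totient n) / L1 \<le> real (F n) \<and>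
      (\<exists>p. prime p \<and> real (p * p) > M \<and> p * p dvd n)"
  shows "(\<Sum>n\<in>S. real (F n)) \<le> 2 * (1 + ln L1) ^ 2 / (M * ln M) * x ^ 2"
proof -
  define A where "A = {p. real p \<le> L1 \<and> sqrt M \<le> real p}"
  have finA: "finite A"
    by (rule finite_subset[of _ "{..nat \<lfloor>L1\<rfloor>}"]) (auto simp: A_def le_nat_floor)
  have A: "real p > 0" if "p \<in> A" for p
    using that assms(4) by (auto simp: A_def intro!: Nat.gr0I)
  define T where "T p = {n. 0 < n \<and> real n \<le> x \<and> p * p dvd n}" for p :: nat
  have finT: "finite (T p)" for p
    by (rule finite_subset[of _ "{..nat \<lfloor>x\<rfloor>}"]) (auto simp: T_def le_nat_floor)
  have "(\<Sum>n\<in>S. real (F n)) \<le> (\<Sum>(p, n)\<in>(SIGMA p:A. T p). x / real p)"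
  proof (rule sum_le_included[where i = snd], goal_cases)
    case 4
    show ?case
    proof
      fix n assume "n \<in> S"
      from S[OF this] obtain p where n: "n > 1" "real n \<le> x" "odd n" "real (totient n) / L1 \<le> real (F n)"
        and p: "prime p" "real (p * p) > M" "p * p dvd n" by blast
      have "F n * p \<le> totient n" using p n by (intro F_square_le) (auto simp: power2_eq_square)
      then have F: "real p \<le> L1" "real (F n) * real p \<le> real n"
        using index_mult_le_of_F_ge[of n L1 p] n assms(3) by auto
      have "sqrt M \<le> sqrt (real p ^ 2)" using p(2) by (intro real_sqrt_le_mono) (simp add: power2_eq_square)
      then have pA: "p \<in> A" using F by (simp add: A_def)
      have "n \<in> T p" using n p by (simp add: T_def)
      moreover have "real (F n) \<le> x / real p"
        using F(2) n(2) A[OF pA] by (simp add: field_simps)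
      ultimately show "\<exists>y\<in>(SIGMA p:A. T p). snd y = n \<and> real (F n) \<le> (case y of (p, n) \<Rightarrow> x / real p)"
        using pA by (intro bexI[of _ "(p, n)"]) auto
    qed
  qed (use assms finA finT in \<open>auto intro!: finite_SigmaI\<close>)
  also have "\<dots> = (\<Sum>p\<in>A. \<Sum>n\<in>T p. x / real p)"
    using finA finT by (intro sum.Sigma[symmetric]) auto
  also have "\<dots> \<le> (\<Sum>p\<in>A. x ^ 2 / sqrt M * (1 / real p ^ 2))"
  proof (rule sum_mono)
    fix p assume p: "p \<in> A"
    have sq: "0 < sqrt M" "sqrt M \<le> real p" using p assms by (auto simp: A_def)
    have "(\<Sum>n\<in>T p. x / real p) = x / real p * real (card (T p))" by simp
    also have "\<dots> \<le> x / real p * (x / real (p * p))"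
      unfolding T_def using A[OF p] assms(2) by (intro mult_left_mono card_multiples_le) auto
    also have "\<dots> = x ^ 2 / real p * (1 / real p ^ 2)" by (simp add: power2_eq_square)
    \<comment> \<open>One factor 1/p is traded for 1/sqrt M, so that the tail bound for inverse
      squares supplies the other 1/sqrt M.\<close>
    also have "\<dots> \<le> x ^ 2 / sqrt M * (1 / real p ^ 2)"
      using sq A[OF p] by (intro mult_right_mono divide_left_mono mult_pos_pos) auto
    finally show "(\<Sum>n\<in>T p. x / real p) \<le> x ^ 2 / sqrt M * (1 / real p ^ 2)" .
  qed
  also have "\<dots> = x ^ 2 / sqrt M * (\<Sum>p\<in>A. 1 / real p ^ 2)" by (simp add: sum_distrib_left)
  also have "\<dots> \<le> 2 * (1 + ln L1) ^ 2 / (M * ln M) * x ^ 2"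
  \<comment> \<open>If \<open>A\<close> is empty the sum vanishes. Otherwise sqrt M <= L1, so ln M
    <= 2 ln L1 <= (1 + ln L1)^2, and the bound 2 x^2 / M may be multiplied by (1 + ln L1)^2 / ln
    M.\<close>
  proof (cases "A = {}")
    case True
    then show ?thesis using assms by simp
  next
    case False
    then have "sqrt M \<le> L1" by (auto simp: A_def)
    then have "sqrt M ^ 2 \<le> L1 ^ 2" using assms by (intro power_mono) auto
    then have "ln M \<le> ln (L1 ^ 2)" using assms by simp
    also have "\<dots> = 2 * ln L1" using assms by (simp add: ln_realpow)
    finally have lnM: "ln M \<le> 2 * ln L1" .
    have l: "ln L1 > 0" using assms by simp
    have "x ^ 2 / sqrt M * (\<Sum>p\<in>A. 1 / real p ^ 2) \<le> x ^ 2 / sqrt M * (2 / sqrt M)"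
      using finA assms by (intro mult_left_mono sum_inverse_squares_tail_le) (auto simp: A_def)
    also have "\<dots> = x ^ 2 * 2 / (sqrt M * sqrt M)" by simp
    also have "\<dots> = 2 / M * x ^ 2" using assms by simp
    also have "\<dots> \<le> 2 * (1 + ln L1) ^ 2 / (M * ln M) * x ^ 2"
    proof (rule mult_right_mono)
      have "ln M \<le> (1 + ln L1) ^ 2" using lnM zero_le_power2[of "ln L1"] unfolding power2_sum power_one mult_1_right by linarith
      then have "2 / M * 1 \<le> 2 / M * ((1 + ln L1) ^ 2 / ln M)"
        using assms by (intro mult_left_mono) auto
      then show "2 / M \<le> 2 * (1 + ln L1) ^ 2 / (M * ln M)" by simp
    qed simp
    finally show ?thesis .
  qed
  finally show ?thesis .
qed

section \<open>Comparison of the constants\<close>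

lemma ln_ge_33_16:
  fixes y :: real
  assumes "10 \<le> y"
  shows "33 / 16 \<le> ln y"
proof -
  \<comment> \<open>From 10 = 8 / (4/5) one gets ln 10 >= 3 * (2/3) + 1/5 = 2.2. The target 33/16 is
    what makes 1 + ln y at least 49/16, twice the constant 49/32.\<close>
  have "ln (2 :: real) \<ge> 2 / 3" by (rule ln2_ge_two_thirds)
  moreover have "ln (8 :: real) = 3 * ln 2" using ln_realpow[of 2 3] by simp
  moreover have "ln (4 / 5 :: real) \<le> 4 / 5 - 1" by (rule ln_le_minus_one) simp
  moreover have "ln (10 :: real) = ln 8 - ln (4 / 5)" using ln_div[of 8 "4 / 5 :: real"] by simp
  moreover have "ln 10 \<le> ln y" using assms by simp
  ultimately show ?thesis by linarith
qed

text \<open>Applied with a = ln L1, l = ln L and z = zeta(3) - 1. The identity (4+a)^2 - 12 (1+a) =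
  (a-2)^2 gives the factor 144 after squaring, and 144 / 12 * 1/6 = 2 matches the left side.\<close>

lemma main_term_le:
  fixes a l M L z :: real
  assumes "a \<ge> 0" "l \<ge> 0" "L \<ge> 0" "2 * L < M" "z \<ge> 1 / 6"
  shows "2 / (M - L) * (1 + a) ^ 2 * (1 + l) ^ 2 \<le> 1 / (12 * (M - 2 * L)) * (1 + l) * (4 + a) ^ 4 * (5 / 12 + z * (1 + l))"
proof -
  have "12 * (1 + a) \<le> (4 + a) ^ 2"
    using zero_le_power2[of "a - 2"] by (simp add: power2_eq_square algebra_simps)
  then have "(12 * (1 + a)) ^ 2 \<le> ((4 + a) ^ 2) ^ 2" using assms by (intro power_mono) auto
  then have a: "144 * (1 + a) ^ 2 \<le> (4 + a) ^ 4"
    unfolding power_mult_distrib power_mult[symmetric] by simp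
  have z: "1 / 6 * (1 + l) \<le> 5 / 12 + z * (1 + l)"
    using assms mult_right_mono[of "1/6" z "1 + l"] by linarith
  have "2 / (M - L) * (1 + a) ^ 2 * (1 + l) ^ 2 \<le> 2 / (M - 2 * L) * (1 + a) ^ 2 * (1 + l) ^ 2"
    using assms by (intro mult_right_mono divide_left_mono) auto
  also have "\<dots> = 1 / (12 * (M - 2 * L)) * (1 + l) * (144 * (1 + a) ^ 2) * (1 / 6 * (1 + l))"
    using assms by (simp add: field_simps power2_eq_square)
  also have "\<dots> \<le> 1 / (12 * (M - 2 * L)) * (1 + l) * (4 + a) ^ 4 * (5 / 12 + z * (1 + l))"
    using assms a z by (intro mult_mono mult_nonneg_nonneg) auto
  finally show ?thesis .
qed

section \<open>The two largest prime factors and the final estimate\<close>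

lemma Pplus_prime_factor:
  assumes "m > 1"
  shows "prime (Pplus m)" "Pplus m dvd m"
    and "\<And>p. prime p \<Longrightarrow> p dvd m \<Longrightarrow> p \<le> Pplus m"
proof -
  have "prime_factors m \<noteq> {}" using assms by (simp add: prime_factorization_empty_iff)
  then have "Pplus m \<in> prime_factors m" unfolding Pplus_def by (intro Max_in) auto
  then show "prime (Pplus m)" "Pplus m dvd m" by auto
  show "p \<le> Pplus m" if "prime p" "p dvd m" for p
    unfolding Pplus_def using that assms by (intro Max_ge) (auto simp: prime_factors_dvd)
qed

text \<open>Since n is not prime, n / P exceeds 1, so Q is a genuine prime factor and not the
  maximum of an empty set. As Q also divides n, maximality of P gives Q <= P.\<close>

lemma Pplus_composite:
  assumes "n > 1" "\<not> prime n"
  defines "p \<equiv> Pplus n" and "q \<equiv> Pplus (n div Pplus n)"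
  shows "prime p" "prime q" "q \<le> p" "p * q dvd n"
proof -
  note P = Pplus_prime_factor[OF assms(1)]
  show "prime p" using P by (simp add: p_def)
  have eq: "n = p * (n div p)" using P by (simp add: p_def)
  have "n div p \<noteq> 0" "n div p \<noteq> 1" using eq assms(1,2) \<open>prime p\<close> by (metis mult_0_right not_one_less_zero, metis mult.right_neutral)
  then have "n div p > 1" by simp
  note Q = Pplus_prime_factor[OF this]
  show "prime q" using Q by (simp add: p_def q_def)
  have q: "q dvd n div p" using Q by (simp add: p_def q_def)
  then show "p * q dvd n" using eq by (metis dvd_refl mult_dvd_mono)
  then show "q \<le> p" using P(3)[OF \<open>prime q\<close>] by (auto simp: p_def[symmetric] dest: dvd_mult_right)
qed

theorem theorem4p3:
  fixes L1 L M x :: real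
  assumes "10 < L1" "L1 < L" "L < M / 2" "x > L^2" "L^2 > M"
  defines "\<N> \<equiv> {n::nat. odd n \<and> n > 1 \<and> \<not> prime n \<and> real n \<le> x \<and>
              real (Pplus n) \<le> L \<and>
              real (Pplus n * Pplus (n div Pplus n)) > M \<and>
              real (F n) \<ge> real (totient n) / L1}"
  defines "C \<equiv> L^2 / (2 * x) * (1 + ln L1) + 2 * (1 + ln L1)^2 / (M * ln M)
              + 1 / (12 * (M - 2 * L)) * (1 + ln L) * (4 + ln L1)^4
                * (5 / 12 + (zeta_real 3 - 1) * (1 + ln L))"
  shows "(\<Sum>n\<in>\<N>. real (F n)) \<le> x^2 * C"
proof -
  have x: "x > 0" using assms(1,2,4) by (smt (verit) zero_le_power2)
  have M: "M > 1" "L < M" "2 * L < M" using assms by auto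
  have fin: "finite \<N>"
    by (rule finite_subset[of _ "{..nat \<lfloor>x\<rfloor>}"]) (auto simp: \<N>_def le_nat_floor)
  \<comment> \<open>\<open>E\<close> collects the n with P = Q, for which P^2 divides n; on the
    complement Q < P.\<close>
  define E where "E = {n \<in> \<N>. Pplus (n div Pplus n) = Pplus n}"
  have "(\<Sum>n\<in>\<N>. real (F n)) = (\<Sum>n\<in>\<N> - E. real (F n)) + (\<Sum>n\<in>E. real (F n))"
    using fin by (intro sum.subset_diff) (auto simp: E_def)
  also have "\<dots> \<le> (49 / 32 * L ^ 2 * x + 2 / (M - L) * (1 + ln L1) ^ 2 * (1 + ln L) ^ 2 * x ^ 2)
                + 2 * (1 + ln L1) ^ 2 / (M * ln M) * x ^ 2"
  proof (rule add_mono)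
    show "(\<Sum>n\<in>\<N> - E. real (F n)) \<le> 49 / 32 * L ^ 2 * x + 2 / (M - L) * (1 + ln L1) ^ 2 * (1 + ln L) ^ 2 * x ^ 2"
    proof (rule sum_F_distinct_le)
      fix n assume "n \<in> \<N> - E"
      then have n: "odd n" "n > 1" "\<not> prime n" "real n \<le> x" "real (Pplus n) \<le> L"
        "real (Pplus n * Pplus (n div Pplus n)) > M" "real (F n) \<ge> real (totient n) / L1"
        "Pplus (n div Pplus n) \<noteq> Pplus n" by (auto simp: \<N>_def E_def)
      note P = Pplus_composite[OF n(2,3)]
      have "Pplus (n div Pplus n) < Pplus n" using P n by simp
      moreover have "Pplus n dvd n" "Pplus (n div Pplus n) dvd n"
        using P(4) by (auto dest: dvd_mult_left dvd_mult_right)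
      ultimately show "n > 1 \<and> real n \<le> x \<and> odd n \<and> real (totient n) / L1 \<le> real (F n) \<and>
        (\<exists>p q. prime p \<and> prime q \<and> q < p \<and> real p \<le> L \<and> real (p * q) > M \<and> p dvd n \<and> q dvd n)"
        using P n by blast
    qed (use assms x M fin in auto)
    show "(\<Sum>n\<in>E. real (F n)) \<le> 2 * (1 + ln L1) ^ 2 / (M * ln M) * x ^ 2"
    proof (rule sum_F_square_le)
      show "finite E" using fin by (simp add: E_def)
      fix n assume "n \<in> E"
      then have n: "odd n" "n > 1" "\<not> prime n" "real n \<le> x" "real (Pplus n * Pplus n) > M"
        "real (F n) \<ge> real (totient n) / L1" "Pplus (n div Pplus n) = Pplus n" by (auto simp: \<N>_def E_def)
      show "n > 1 \<and> real n \<le> x \<and> odd n \<and> real (totient n) / L1 \<le> real (F n) \<and>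
        (\<exists>p. prime p \<and> real (p * p) > M \<and> p * p dvd n)"
        using Pplus_composite[OF n(2,3)] n by metis
    qed (use assms x M in auto)
  qed
  also have "\<dots> \<le> (L ^ 2 * x / 2 * (1 + ln L1) + 1 / (12 * (M - 2 * L)) * (1 + ln L) * (4 + ln L1) ^ 4
                * (5 / 12 + (zeta_real 3 - 1) * (1 + ln L)) * x ^ 2)
                + 2 * (1 + ln L1) ^ 2 / (M * ln M) * x ^ 2"
  \<comment> \<open>The error term is absorbed by 49/16 <= 1 + ln L1, the main term by
    \<open>main_term_le\<close>; the repeated prime term already has its final form.\<close>
  proof (intro add_mono mult_right_mono order_refl)
    have "49 / 16 \<le> 1 + ln L1" using ln_ge_33_16[of L1] assms(1) by simp
    then have "L ^ 2 * x / 2 * (49 / 16) \<le> L ^ 2 * x / 2 * (1 + ln L1)"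
      using x by (intro mult_left_mono) auto
    then show "49 / 32 * L ^ 2 * x \<le> L ^ 2 * x / 2 * (1 + ln L1)" by simp
    show "2 / (M - L) * (1 + ln L1) ^ 2 * (1 + ln L) ^ 2 \<le> 1 / (12 * (M - 2 * L)) * (1 + ln L) * (4 + ln L1) ^ 4
                * (5 / 12 + (zeta_real 3 - 1) * (1 + ln L))"
      using assms M zeta_real_3_ge by (intro main_term_le) auto
  qed (use zero_le_power2[of x] in auto)
  also have "\<dots> = x ^ 2 * C"
  proof -
    have "L ^ 2 * x / 2 * (1 + ln L1) = x ^ 2 * (L ^ 2 / (2 * x) * (1 + ln L1))"
      using x by (simp add: power2_eq_square)
    then show ?thesis unfolding C_def by (simp only: distrib_left mult.commute[of _ "x ^ 2"])
  qed
  finally show ?thesis .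
qed

end
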